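(* For every $n\in\mathbb{N}$, \[ N_{(1,9)}(n)=8\sigma(n)-32\sigma(\tfrac n4)+8\sigma(\tfrac n9)-32\sigma(\tfrac n{36})+64W_{(1,9)}(n)+1024W_{(1,9)}(\tfrac n4)-256\bigl(W_{(4,9)}(n)+W_{(1,36)}(n)\bigr). \]
   Context: $\sigma_k(n)=\sum_{d\mid n}d^k$ for $n\in\mathbb{N}$, $\sigma_k(x)=0$ for $x\notin\mathbb{N}$, $\sigma=\sigma_1$. $W_{(\alpha,\beta)}(n)=\sum_{(l,m)\in\mathbb{N}_0^2,\ \alpha l+\beta m=n}\sigma(l)\sigma(m)$, and $W_{(\alpha,\beta)}(x)=0$ if $x\notin\mathbb{N}$. For $a,b\in\mathbb{N}$, $N_{(a,b)}(n)$ is the number of $(x_1,\dots,x_8)\in\mathbb{Z}^8$ with $n=a(x_1^2+x_2^2+x_3^2+x_4^2)+b(x_5^2+x_6^2+x_7^2+x_8^2)$. *)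

theory Defs
  imports "HOL-Analysis.Analysis"
begin

text \<open>Positive integers are the natural numbers here (paper's convention: N = {1,2,...}).\<close>
definition is_pos_nat :: "real \<Rightarrow> bool" where
  "is_pos_nat x \<longleftrightarrow> (\<exists>n::nat. n \<ge> 1 \<and> x = real n)"

definition sigmak :: "nat \<Rightarrow> real \<Rightarrow> real" where
  "sigmak k x = (if is_pos_nat x then (\<Sum>d | d dvd nat \<lfloor>x\<rfloor>. real d ^ k) else 0)"

abbreviation sig :: "real \<Rightarrow> real" where
  "sig \<equiv> sigmak 1"

definition W :: "nat \<Rightarrow> nat \<Rightarrow> real \<Rightarrow> real" where
  "W \<alpha> \<beta> x = (if is_pos_nat x then
      (\<Sum>p \<in> {(l, m). \<alpha> * l + \<beta> * m = nat \<lfloor>x\<rfloor>}. sig (real (fst p)) * sig (real (snd p)))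
    else 0)"

text \<open>N_(a,b)(n): number of (x_1,...,x_8) in Z^8 with
  n = a(x_1^2+...+x_4^2) + b(x_5^2+...+x_8^2); tuples are functions {0..<8} -> Z
  (extended by 0 outside).\<close>
definition Nrep :: "nat \<Rightarrow> nat \<Rightarrow> nat \<Rightarrow> nat" where
  "Nrep a b n = card {x :: nat \<Rightarrow> int. (\<forall>i\<ge>8. x i = 0) \<and>
      int n = int a * (\<Sum>i<4. (x i)^2) + int b * (\<Sum>i\<in>{4..<8}. (x i)^2)}"

end

theory Submission
  imports Defs
begin

text \<open>By Jacobi's theorem the number of representations of \<open>m \<ge> 1\<close> as a sum of four squares is
  \<open>r(m) = 8 \<sigma>(m) - 32 \<sigma>(m/4)\<close>; the formula follows by expanding the convolution of \<open>r(l)\<close> and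
  \<open>r(m)\<close> over \<open>l + 9 m = n\<close>.

  Jacobi's theorem is proved by showing that both sides satisfy the recurrence
  \<open>\<Sum>x. (n - 5 x\<^sup>2) r(n - x\<^sup>2) = 0\<close> over integers \<open>x\<close> with \<open>x\<^sup>2 \<le> n\<close>, which determines
  \<open>r\<close> from \<open>r(0) = 1\<close>. On the divisor side, \<open>\<sigma>(m) - 4 \<sigma>(m/4)\<close> is the sum of \<open>\<plusminus>d\<close> over
  \<open>d e = m\<close>, the sign being negative iff \<open>d\<close> and \<open>e\<close> are both even. The recurrence is then a
  weighted sum over the solutions of \<open>x\<^sup>2 + d e = n\<close>. The swap \<open>(x, d, e) \<mapsto> (-x, e, d)\<close>
  folds it onto \<open>2 x > d - e\<close>, where Zagier's involution \<open>(x, d, e) \<mapsto> (d - x, d, e + 2 x - d)\<close>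
  cancels it. Only the diagonal \<open>2 x = d - e\<close> is left, which occurs for square \<open>n\<close> alone.\<close>

section \<open>Jacobi's four-square theorem\<close>

definition parity_sign :: "int \<Rightarrow> int \<Rightarrow> int" where
  "parity_sign d e = (if even d \<and> even e then -1 else 1)"

definition form_triples :: "int \<Rightarrow> (int \<times> int \<times> int) set" where
  "form_triples n = {(x, d, e). 0 < d \<and> 0 < e \<and> x\<^sup>2 + d * e = n}"

definition factor_pairs :: "int \<Rightarrow> (int \<times> int) set" where
  "factor_pairs m = {(d, e). 0 < d \<and> 0 < e \<and> d * e = m}"

definition signed_sigma :: "int \<Rightarrow> int" where
  "signed_sigma m = (\<Sum>(d, e) \<in> factor_pairs m. parity_sign d e * d)"

section \<open>Finiteness of the index sets\<close>

lemma factor_le: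
  fixes d e m :: int
  assumes "0 < d" "0 < e" "d * e \<le> m"
  shows "d \<le> m" "e \<le> m"
proof -
  have "d * 1 \<le> d * e" "1 * e \<le> d * e"
    using assms by (auto intro!: mult_left_mono mult_right_mono)
  then show "d \<le> m" "e \<le> m" using assms by linarith+
qed

lemma abs_le_of_square_le:
  fixes x n :: int
  assumes "x\<^sup>2 \<le> n"
  shows "\<bar>x\<bar> \<le> n"
proof (cases "x = 0")
  case False
  then have "\<bar>x\<bar> * 1 \<le> \<bar>x\<bar> * \<bar>x\<bar>" by (intro mult_left_mono) auto
  then show ?thesis using assms by (simp add: power2_eq_square)
qed (use assms in auto)

lemma finite_square_le [simp]: "finite {x :: int. x\<^sup>2 \<le> n}"
  by (rule finite_subset[of _ "{-n..n}"]) (auto dest!: abs_le_of_square_le)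

lemma finite_square_less [simp]: "finite {x :: int. x\<^sup>2 < n}"
  by (rule finite_subset[OF _ finite_square_le[of n]]) auto

lemma finite_square_eq [simp]: "finite {x :: int. x\<^sup>2 = n}"
  by (rule finite_subset[OF _ finite_square_le[of n]]) auto

lemma finite_factor_pairs [simp]: "finite (factor_pairs m)"
proof (rule finite_subset)
  show "factor_pairs m \<subseteq> {0..m} \<times> {0..m}"
  proof
    fix t assume "t \<in> factor_pairs m"
    then show "t \<in> {0..m} \<times> {0..m}"
      using factor_le[of "fst t" "snd t" m] by (auto simp: factor_pairs_def)
  qed
qed auto

lemma finite_form_triples [simp]: "finite (form_triples n)"
proof (rule finite_subset)
  show "form_triples n \<subseteq> {-n..n} \<times> {0..n} \<times> {0..n}"
  proof
    fix t assume t: "t \<in> form_triples n"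
    obtain x d e where [simp]: "t = (x, d, e)" by (cases t)
    from t have de: "0 < d" "0 < e" "x\<^sup>2 + d * e = n" by (auto simp: form_triples_def)
    have "0 \<le> x\<^sup>2" by simp
    moreover have "0 < d * e" using de by simp
    ultimately have "x\<^sup>2 \<le> n" "d * e \<le> n" using de(3) by linarith+
    then have "\<bar>x\<bar> \<le> n" "d \<le> n" "e \<le> n"
      using abs_le_of_square_le[of x n] factor_le[of d e n] de(1,2) by simp_all
    then show "t \<in> {-n..n} \<times> {0..n} \<times> {0..n}" using de by auto
  qed
qed auto

text \<open>The term \<open>x * (d\<^sup>2 - e\<^sup>2)\<close> is odd in \<open>x\<close>, so it does not change the sum over all triples; it is
  added to make the symmetrised weight antisymmetric under Zagier's involution.\<close>

definition triple_weight :: "int \<times> int \<times> int \<Rightarrow> int" where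
  "triple_weight = (\<lambda>(x, d, e). parity_sign d e * (d * (d * e - 4 * x\<^sup>2) + x * (d\<^sup>2 - e\<^sup>2)))"

section \<open>Involutions on the triples and the cancellation they give\<close>

definition triple_swap :: "int \<times> int \<times> int \<Rightarrow> int \<times> int \<times> int" where
  "triple_swap = (\<lambda>(x, d, e). (-x, e, d))"

definition zagier :: "int \<times> int \<times> int \<Rightarrow> int \<times> int \<times> int" where
  "zagier = (\<lambda>(x, d, e). (d - x, d, e + 2 * x - d))"

text \<open>Up to the sign, the symmetrised weight factors as
  \<open>(d + e) * (d - 2 * x) * (e + 2 * x)\<close>; the involution exchanges the outer factors and
  negates the middle one. The sign is kept because \<open>e + 2 * x - d\<close> has the parity of
  \<open>e\<close> whenever \<open>d\<close> is even.\<close>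

lemma zagier_antisymmetric:
  "triple_weight (zagier t) + triple_weight (triple_swap (zagier t)) =
   - (triple_weight t + triple_weight (triple_swap t))"
proof -
  obtain x d e where t: "t = (x, d, e)" by (cases t)
  have eps: "parity_sign d (e + 2 * x - d) = parity_sign d e"
    "parity_sign (e + 2 * x - d) d = parity_sign d e" "parity_sign e d = parity_sign d e"
    by (auto simp: parity_sign_def)
  show ?thesis
    unfolding t zagier_def triple_swap_def triple_weight_def prod.case eps
    by (simp add: algebra_simps power2_eq_square)
qed

lemma sum_triple_weight_upper:
  "(\<Sum>t \<in> {(x, d, e) \<in> form_triples n. 2 * x > d - e}.
      triple_weight t + triple_weight (triple_swap t)) = 0"
    (is "sum ?g ?P = 0")
proof -
  \<comment> \<open>The involution interchanges the two conditions \<open>2 * x > d - e\<close> and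
    \<open>e > 0\<close>, and it preserves \<open>x\<^sup>2 + d * e\<close>.\<close>
  have "zagier t \<in> ?P" if "t \<in> ?P" for t
    using that by (auto simp: zagier_def form_triples_def algebra_simps power2_eq_square)
  moreover have "zagier (zagier t) = t" for t
    by (cases t) (simp add: zagier_def)
  ultimately have "sum ?g ?P = sum (\<lambda>t. ?g (zagier t)) ?P"
    by (intro sum.reindex_bij_witness[of _ zagier zagier]) auto
  also have "\<dots> = - sum ?g ?P"
    by (simp only: zagier_antisymmetric sum_negf)
  finally show ?thesis by simp
qed

text \<open>On the diagonal \<open>n = (x + e)\<^sup>2\<close>. With \<open>s = x + e\<close> the
  triples are parametrised by \<open>d\<close> from \<open>1\<close> to \<open>2 * s - 1\<close>,
  and the sum becomes an alternating sum of a cubic in \<open>d\<close>.\<close>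

lemma sum_triple_weight_diagonal:
  assumes "n > 0"
  shows "(\<Sum>t \<in> {(x, d, e) \<in> form_triples n. 2 * x = d - e}. triple_weight t) =
    (if \<exists>s. s\<^sup>2 = n then n else 0)"
proof (cases "\<exists>s. s\<^sup>2 = n")
  case False
  have "(x + e)\<^sup>2 = n" if "(x, d, e) \<in> form_triples n" "2 * x = d - e" for x d e
  proof -
    have d: "d = 2 * x + e" using that by simp
    show ?thesis using that(1) unfolding d
      by (simp add: form_triples_def algebra_simps power2_eq_square)
  qed
  then have "{(x, d, e) \<in> form_triples n. 2 * x = d - e} = {}" using False by blast
  then have "(\<Sum>t \<in> {(x, d, e) \<in> form_triples n. 2 * x = d - e}. triple_weight t) = 0"
    by (simp only: sum.empty)
  then show ?thesis using False by simp
next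
  case True
  then obtain s0 where s0: "s0\<^sup>2 = n" by blast
  define k s where "k = nat \<bar>s0\<bar>" and "s = int k"
  have "s0 \<noteq> 0" using s0 assms by auto
  then have s: "s\<^sup>2 = n" "s > 0" and k: "k > 0" using s0 by (simp_all add: s_def k_def)
  \<comment> \<open>The weight at \<open>x = d - s\<close>, \<open>e = 2 * s - d\<close>, without
    its sign.\<close>
  define p where "p d = -5 * d^3 + 14 * s * d\<^sup>2 - 12 * s\<^sup>2 * d + 4 * s^3" for d :: int
  let ?D = "{(x, d, e) \<in> form_triples n. 2 * x = d - e}"
  have D: "x = d - s \<and> e = 2 * s - d \<and> 0 < d \<and> 0 < e"
    if "(x, d, e) \<in> form_triples n" "2 * x = d - e" for x d e
  proof -
    have d: "d = 2 * x + e" using that by simp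
    have "(x + e)\<^sup>2 = n" "0 < d" "0 < e" using that(1) unfolding d
      by (simp_all add: form_triples_def algebra_simps power2_eq_square)
    moreover from this have "x + e > 0" unfolding d by linarith
    ultimately have "x + e = s" using s by (simp add: power2_eq_imp_eq)
    then show ?thesis using d \<open>0 < d\<close> \<open>0 < e\<close> by auto
  qed
  have sum_D: "sum triple_weight ?D = (\<Sum>j = 1..2 * k - 1. (-1) ^ (j - 1) * p (int j))"
  proof (rule sum.reindex_bij_witness[of _ "\<lambda>j. (int j - s, int j, 2 * s - int j)" "\<lambda>(x, d, e). nat d"])
    fix t assume t: "t \<in> ?D"
    obtain x d e where [simp]: "t = (x, d, e)" by (cases t)
    from t D[of x d e] have xe: "x = d - s" "e = 2 * s - d" "0 < d" "0 < e" by auto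
    then show "(int (case t of (x, d, e) \<Rightarrow> nat d) - s, int (case t of (x, d, e) \<Rightarrow> nat d),
        2 * s - int (case t of (x, d, e) \<Rightarrow> nat d)) = t" by simp
    show "(case t of (x, d, e) \<Rightarrow> nat d) \<in> {1..2 * k - 1}"
      using xe by (auto simp: s_def)
    have "parity_sign d e = (-1) ^ (nat d - 1)"
      using xe by (auto simp: parity_sign_def even_nat_iff)
    moreover have "d * (d * e - 4 * x\<^sup>2) + x * (d\<^sup>2 - e\<^sup>2) = p d"
      unfolding xe(1,2) p_def by (simp add: algebra_simps power2_eq_square power3_eq_cube)
    ultimately show "(-1) ^ ((case t of (x, d, e) \<Rightarrow> nat d) - 1) * p (int (case t of (x, d, e) \<Rightarrow> nat d))
        = triple_weight t"
      using xe(3) by (simp add: triple_weight_def)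
  next
    fix j assume "j \<in> {1..2 * k - 1}"
    then have "0 < int j" "0 < 2 * s - int j" by (auto simp: s_def)
    moreover have "(int j - s)\<^sup>2 + int j * (2 * s - int j) = n"
      unfolding s(1)[symmetric] by (simp add: algebra_simps power2_eq_square)
    ultimately show "(int j - s, int j, 2 * s - int j) \<in> ?D"
      by (simp add: form_triples_def)
  qed auto
  \<comment> \<open>Replacing each power \<open>d^i\<close> in \<open>p d\<close> by the Euler
    polynomial of degree \<open>i\<close> at \<open>m + 1\<close>, and multiplying by 4, gives
    \<open>q m\<close>. Hence \<open>q m + q (m + 1) = 8 * p (m + 1)\<close>, so the alternating sum
    telescopes.\<close>
  define q where "q m = -5 * (4 * m^3 + 6 * m^2 - 1) + 56 * s * (m^2 + m)
      - 24 * s\<^sup>2 * (2 * m + 1) + 16 * s^3" for m :: int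
  have closed_form: "8 * (\<Sum>j = 1..m. (-1) ^ (j - 1) * p (int j)) = q 0 - (-1) ^ m * q (int m)" for m
  proof (induction m)
    case (Suc m)
    have "8 * p (int m + 1) = q (int m) + q (int m + 1)"
      unfolding p_def q_def by (simp add: algebra_simps power2_eq_square power3_eq_cube)
    then have "(-1) ^ m * (8 * p (int m + 1)) = (-1) ^ m * q (int m) + (-1) ^ m * q (int m + 1)"
      by (simp only: distrib_left)
    with Suc.IH show ?case by (simp add: distrib_left add.commute)
  qed simp
  have "int (2 * k - 1) = 2 * s - 1" "(-1) ^ (2 * k - 1) = (-1 :: int)"
    using k by (auto simp: s_def)
  then have "8 * sum triple_weight ?D = q 0 + q (2 * s - 1)"
    unfolding sum_D closed_form by simp
  also have "\<dots> = 8 * s\<^sup>2"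
    unfolding q_def by (simp add: algebra_simps power2_eq_square power3_eq_cube)
  finally have "sum triple_weight ?D = n" using s by simp
  then show ?thesis using True by simp
qed

lemma sum_form_triples:
  assumes "n > 0"
  shows "(\<Sum>(x, d, e) \<in> form_triples n. parity_sign d e * d * (n - 5 * x\<^sup>2)) =
    (if \<exists>s. s\<^sup>2 = n then n else 0)"
proof -
  let ?S = "form_triples n"
  let ?odd = "\<lambda>(x, d, e). parity_sign d e * (x * (d\<^sup>2 - e\<^sup>2))"
  let ?P = "{(x, d, e) \<in> ?S. 2 * x > d - e}" and ?R = "{(x, d, e) \<in> ?S. 2 * x < d - e}"
    and ?D = "{(x, d, e) \<in> ?S. 2 * x = d - e}"
  have fin: "finite ?P" "finite ?R" "finite ?D"
    by (auto intro: finite_subset[OF _ finite_form_triples[of n]])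
  have "sum ?odd ?S = - sum ?odd ?S"
    unfolding sum_negf[symmetric]
    by (rule sum.reindex_bij_witness[of _ "\<lambda>(x, d, e). (-x, d, e)" "\<lambda>(x, d, e). (-x, d, e)"])
      (auto simp: form_triples_def)
  then have odd: "sum ?odd ?S = 0" by simp
  \<comment> \<open>On these triples \<open>n - 5 * x\<^sup>2 = d * e - 4 * x\<^sup>2\<close>, the
    factor that occurs in \<open>triple_weight\<close>.\<close>
  have "(\<Sum>(x, d, e) \<in> ?S. parity_sign d e * d * (n - 5 * x\<^sup>2)) =
      (\<Sum>t \<in> ?S. triple_weight t - ?odd t)"
    by (rule sum.cong) (auto simp: form_triples_def triple_weight_def algebra_simps)
  also have "\<dots> = sum triple_weight ?S"
    by (simp add: sum_subtractf odd)
  also have "\<dots> = sum triple_weight ((?P \<union> ?R) \<union> ?D)"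
    by (rule arg_cong[of _ _ "sum triple_weight"]) auto
  also have "\<dots> = sum triple_weight (?P \<union> ?R) + sum triple_weight ?D"
    using fin by (intro sum.union_disjoint) auto
  also have "sum triple_weight (?P \<union> ?R) = sum triple_weight ?P + sum triple_weight ?R"
    using fin by (intro sum.union_disjoint) auto
  also have "sum triple_weight ?R = (\<Sum>t \<in> ?P. triple_weight (triple_swap t))"
    by (rule sum.reindex_bij_witness[of _ triple_swap triple_swap])
      (auto simp: triple_swap_def form_triples_def mult.commute)
  finally show ?thesis
    using sum_triple_weight_upper[of n] sum_triple_weight_diagonal[OF assms]
    by (simp add: sum.distrib)
qed

lemma signed_sigma_recurrence:
  assumes "n > 0"
  shows "(\<Sum>x | x\<^sup>2 < n. (n - 5 * x\<^sup>2) * signed_sigma (n - x\<^sup>2)) =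
    (if \<exists>s. s\<^sup>2 = n then n else 0)"
proof -
  have "form_triples n = Sigma {x. x\<^sup>2 < n} (\<lambda>x. factor_pairs (n - x\<^sup>2))"
    by (auto simp: form_triples_def factor_pairs_def)
  then have "(\<Sum>(x, d, e) \<in> form_triples n. parity_sign d e * d * (n - 5 * x\<^sup>2)) =
      (\<Sum>x | x\<^sup>2 < n. \<Sum>(d, e) \<in> factor_pairs (n - x\<^sup>2). parity_sign d e * d * (n - 5 * x\<^sup>2))"
    by (simp add: sum.Sigma)
  also have "\<dots> = (\<Sum>x | x\<^sup>2 < n. (n - 5 * x\<^sup>2) * signed_sigma (n - x\<^sup>2))"
    by (simp add: signed_sigma_def sum_distrib_left case_prod_unfold mult.commute)
  finally show ?thesis using sum_form_triples[OF assms] by simp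
qed

section \<open>Representations as sums of four squares\<close>

definition four_squares :: "int \<Rightarrow> (int \<times> int \<times> int \<times> int) set" where
  "four_squares n = {(a, b, c, d). a\<^sup>2 + b\<^sup>2 + c\<^sup>2 + d\<^sup>2 = n}"

lemma finite_four_squares [simp]: "finite (four_squares n)"
proof (rule finite_subset)
  show "four_squares n \<subseteq> {-n..n} \<times> {-n..n} \<times> {-n..n} \<times> {-n..n}"
  proof
    fix t assume t: "t \<in> four_squares n"
    obtain a b c d where [simp]: "t = (a, b, c, d)" by (cases t)
    have "0 \<le> a\<^sup>2" "0 \<le> b\<^sup>2" "0 \<le> c\<^sup>2" "0 \<le> d\<^sup>2" by simp_all
    moreover have "a\<^sup>2 + b\<^sup>2 + c\<^sup>2 + d\<^sup>2 = n" using t by (simp add: four_squares_def)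
    ultimately have "a\<^sup>2 \<le> n" "b\<^sup>2 \<le> n" "c\<^sup>2 \<le> n" "d\<^sup>2 \<le> n" by linarith+
    then show "t \<in> {-n..n} \<times> {-n..n} \<times> {-n..n} \<times> {-n..n}"
      by (auto dest!: abs_le_of_square_le)
  qed
qed auto

lemma four_squares_zero: "four_squares 0 = {(0, 0, 0, 0)}"
  by (auto simp: four_squares_def add_nonneg_eq_0_iff)

text \<open>Over all representations of \<open>n\<close> as a sum of five squares, \<open>n\<close> sums to five times the sum of
  the first square, by symmetry.\<close>

lemma four_squares_recurrence:
  "(\<Sum>x | x\<^sup>2 \<le> n. (n - 5 * x\<^sup>2) * int (card (four_squares (n - x\<^sup>2)))) = 0"
proof -
  let ?T = "Sigma {x. x\<^sup>2 \<le> n} (\<lambda>x. four_squares (n - x\<^sup>2))"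
  have T: "?T = {(x, a, b, c, d). x\<^sup>2 + a\<^sup>2 + b\<^sup>2 + c\<^sup>2 + d\<^sup>2 = n}"
  proof -
    have "x\<^sup>2 \<le> x\<^sup>2 + a\<^sup>2 + b\<^sup>2 + c\<^sup>2 + d\<^sup>2" for x a b c d :: int
      by (simp add: add.assoc)
    then show ?thesis by (auto simp: four_squares_def)
  qed
  let ?first = "\<Sum>(x, a, b, c, d) \<in> ?T. x\<^sup>2"
  have sym: "(\<Sum>(x, a, b, c, d) \<in> ?T. a\<^sup>2) = ?first" "(\<Sum>(x, a, b, c, d) \<in> ?T. b\<^sup>2) = ?first"
    "(\<Sum>(x, a, b, c, d) \<in> ?T. c\<^sup>2) = ?first" "(\<Sum>(x, a, b, c, d) \<in> ?T. d\<^sup>2) = ?first"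
    unfolding T
    subgoal by (rule sum.reindex_bij_witness[of _ "\<lambda>(x, a, b, c, d). (a, x, b, c, d)"
            "\<lambda>(x, a, b, c, d). (a, x, b, c, d)"]) auto
    subgoal by (rule sum.reindex_bij_witness[of _ "\<lambda>(x, a, b, c, d). (b, a, x, c, d)"
            "\<lambda>(x, a, b, c, d). (b, a, x, c, d)"]) auto
    subgoal by (rule sum.reindex_bij_witness[of _ "\<lambda>(x, a, b, c, d). (c, a, b, x, d)"
            "\<lambda>(x, a, b, c, d). (c, a, b, x, d)"]) auto
    subgoal by (rule sum.reindex_bij_witness[of _ "\<lambda>(x, a, b, c, d). (d, a, b, c, x)"
            "\<lambda>(x, a, b, c, d). (d, a, b, c, x)"]) auto
    done
  have "(\<Sum>x | x\<^sup>2 \<le> n. (n - 5 * x\<^sup>2) * int (card (four_squares (n - x\<^sup>2)))) =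
      (\<Sum>x | x\<^sup>2 \<le> n. \<Sum>t \<in> four_squares (n - x\<^sup>2). n - 5 * x\<^sup>2)"
    by (simp add: mult.commute)
  also have "\<dots> = (\<Sum>(x, t) \<in> ?T. n - 5 * x\<^sup>2)"
    by (rule sum.Sigma) auto
  also have "\<dots> = (\<Sum>(x, a, b, c, d) \<in> ?T. x\<^sup>2 + a\<^sup>2 + b\<^sup>2 + c\<^sup>2 + d\<^sup>2 - 5 * x\<^sup>2)"
    by (rule sum.cong) (auto simp: T)
  also have "\<dots> = 0"
    using sym by (simp add: case_prod_unfold sum.distrib sum_subtractf flip: sum_distrib_left)
  finally show ?thesis .
qed

text \<open>Subtracting eight times the divisor recurrence from the one for
  \<open>four_squares\<close> cancels the boundary terms. By induction only \<open>x = 0\<close>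
  survives, and there the difference of the two sides is multiplied by the nonzero number
  \<open>n\<close>.\<close>

lemma card_four_squares:
  assumes "n > 0"
  shows "int (card (four_squares (int n))) = 8 * signed_sigma (int n)"
  using assms
proof (induction n rule: less_induct)
  case (less n)
  define N where "N = int n"
  define r where "r m = int (card (four_squares m))" for m
  have N: "N > 0" using less.prems by (simp add: N_def)
  have IH: "r (N - x\<^sup>2) = 8 * signed_sigma (N - x\<^sup>2)" if "x\<^sup>2 < N" "x \<noteq> 0" for x :: int
  proof -
    have "0 < x\<^sup>2" using that by simp
    then have "nat (N - x\<^sup>2) < n" "nat (N - x\<^sup>2) > 0" using that unfolding N_def by linarith+
    then show ?thesis using less.IH[of "nat (N - x\<^sup>2)"] that by (simp add: r_def)
  qed
  \<comment> \<open>If \<open>N\<close> is a square, each of its two roots contributes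
    \<open>(N - 5 * N) * r 0 = -4 * N\<close>.\<close>
  have square_card: "(\<Sum>x | x\<^sup>2 = N. (N - 5 * x\<^sup>2) * r (N - x\<^sup>2)) = -8 * (if \<exists>s. s\<^sup>2 = N then N else 0)"
  proof (cases "\<exists>s. s\<^sup>2 = N")
    case True
    then obtain s where s: "s\<^sup>2 = N" by blast
    then have "{x. x\<^sup>2 = N} = {s, -s}" "s \<noteq> -s"
      using N by (auto simp: power2_eq_iff)
    then show ?thesis using True s by (simp add: r_def four_squares_zero)
  qed auto
  have split: "{x. x\<^sup>2 \<le> N} = {x. x\<^sup>2 < N} \<union> {x. x\<^sup>2 = N}" by auto
  have "0 = (\<Sum>x | x\<^sup>2 \<le> N. (N - 5 * x\<^sup>2) * r (N - x\<^sup>2))"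
    using four_squares_recurrence[of N] by (simp add: r_def)
  also have "\<dots> = (\<Sum>x | x\<^sup>2 < N. (N - 5 * x\<^sup>2) * r (N - x\<^sup>2)) +
      (\<Sum>x | x\<^sup>2 = N. (N - 5 * x\<^sup>2) * r (N - x\<^sup>2))"
    unfolding split by (intro sum.union_disjoint) auto
  also have "\<dots> = (\<Sum>x | x\<^sup>2 < N. (N - 5 * x\<^sup>2) * (r (N - x\<^sup>2) - 8 * signed_sigma (N - x\<^sup>2)))"
    unfolding square_card signed_sigma_recurrence[OF N, symmetric]
    by (simp add: sum_distrib_left right_diff_distrib sum_subtractf sum_negf mult.left_commute)
  also have "\<dots> = (\<Sum>x \<in> {0}. (N - 5 * x\<^sup>2) * (r (N - x\<^sup>2) - 8 * signed_sigma (N - x\<^sup>2)))"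
    using N IH by (intro sum.mono_neutral_right) auto
  finally show ?case using N by (simp add: r_def N_def)
qed

section \<open>Divisor sums and convolution sums\<close>

lemma is_pos_nat_of_nat [simp]: "is_pos_nat (real n) \<longleftrightarrow> n \<ge> 1"
  by (auto simp: is_pos_nat_def)

lemma is_pos_nat_divide:
  assumes "k > 0"
  shows "is_pos_nat (real n / real k) \<longleftrightarrow> n \<ge> 1 \<and> k dvd n"
proof
  assume "is_pos_nat (real n / real k)"
  then obtain m where m: "m \<ge> 1" "real n / real k = real m" by (auto simp: is_pos_nat_def)
  then have "real n = real (k * m)" using assms by (simp add: field_simps)
  then have "n = k * m" by (simp only: of_nat_eq_iff)
  then show "n \<ge> 1 \<and> k dvd n" using m assms by auto
next
  assume "n \<ge> 1 \<and> k dvd n"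
  then show "is_pos_nat (real n / real k)"
    using assms by (auto elim!: dvdE)
qed

lemma sigmak_zero [simp]: "sigmak k 0 = 0"
  using is_pos_nat_of_nat[of 0] by (simp add: sigmak_def del: is_pos_nat_of_nat)

lemma sigmak_divide:
  assumes "k > 0"
  shows "sigmak j (real n / real k) = (if k dvd n then sigmak j (real (n div k)) else 0)"
proof (cases "k dvd n")
  case True
  then show ?thesis using assms by (simp add: real_of_nat_div)
next
  case False
  then show ?thesis using is_pos_nat_divide[OF assms, of n] by (simp add: sigmak_def)
qed

lemma sig_factor_pairs:
  "sig (real n) = (\<Sum>(d, e) \<in> factor_pairs (int n). real_of_int d)"
proof (cases "n = 0")
  case True
  then have "factor_pairs (int n) = {}" by (auto simp: factor_pairs_def)
  then show ?thesis using True by simp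
next
  case False
  then have "sig (real n) = (\<Sum>d | d dvd n. real d)" by (simp add: sigmak_def)
  also have "\<dots> = (\<Sum>(d, e) \<in> factor_pairs (int n). real_of_int d)"
  proof (rule sum.reindex_bij_witness[of _ "\<lambda>(d, e). nat d" "\<lambda>d. (int d, int (n div d))"])
    fix t assume "t \<in> factor_pairs (int n)"
    then obtain d e where de: "t = (d, e)" "d > 0" "e > 0" "d * e = int n"
      by (auto simp: factor_pairs_def)
    then have n: "n = nat d * nat e" by (metis nat_int nat_mult_distrib less_imp_le)
    then show "(int (case t of (d, e) \<Rightarrow> nat d), int (n div (case t of (d, e) \<Rightarrow> nat d))) = t"
      using de by simp
    show "(case t of (d, e) \<Rightarrow> nat d) \<in> {d. d dvd n}" using n de by simp
  qed (use False in \<open>auto simp: factor_pairs_def elim!: dvdE\<close>)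
  finally show ?thesis .
qed

text \<open>Flipping the sign of a term \<open>d\<close> subtracts \<open>2 * d\<close>. The pairs
  with both entries even are the doubled factor pairs of \<open>n / 4\<close>, which accounts for
  the second factor 2.\<close>

lemma signed_sigma_eq:
  "real_of_int (signed_sigma (int n)) = sig (real n) - 4 * sig (real n / 4)"
proof -
  let ?E = "{(d, e) \<in> factor_pairs (int n). even d \<and> even e}"
  have "real_of_int (signed_sigma (int n)) =
      (\<Sum>(d, e) \<in> factor_pairs (int n). real_of_int d - (if even d \<and> even e then 2 * real_of_int d else 0))"
    unfolding signed_sigma_def of_int_sum
    by (rule sum.cong) (auto simp: parity_sign_def)
  also have "\<dots> = sig (real n) -
      (\<Sum>(d, e) \<in> factor_pairs (int n). if even d \<and> even e then 2 * real_of_int d else 0)"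
    by (simp add: sig_factor_pairs case_prod_unfold sum_subtractf del: One_nat_def)
  also have "(\<Sum>(d, e) \<in> factor_pairs (int n). if even d \<and> even e then 2 * real_of_int d else 0) =
      (\<Sum>(d, e) \<in> ?E. 2 * real_of_int d)"
    by (rule sum.mono_neutral_cong_right) (auto split: if_splits)
  also have "\<dots> = 4 * sig (real n / 4)"
  proof (cases "4 dvd n")
    case True
    then obtain m where m: "n = 4 * m" by blast
    have "(\<Sum>(d, e) \<in> ?E. 2 * real_of_int d) = (\<Sum>(d, e) \<in> factor_pairs (int m). 4 * real_of_int d)"
      by (rule sum.reindex_bij_witness[of _ "\<lambda>(d, e). (2 * d, 2 * e)" "\<lambda>(d, e). (d div 2, e div 2)"])
        (auto simp: factor_pairs_def m elim!: evenE)
    then show ?thesis using m by (simp add: sig_factor_pairs sum_distrib_left case_prod_unfold del: One_nat_def)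
  next
    case False
    have "4 dvd n" if "(d, e) \<in> ?E" for d e
    proof -
      from that have "even d" "even e" and n: "d * e = int n" by (auto simp: factor_pairs_def)
      then have "2 * 2 dvd d * e" by (intro mult_dvd_mono)
      then have "int 4 dvd int n" unfolding n by simp
      then show ?thesis by (simp only: int_dvd_int_iff)
    qed
    then have "?E = {}" using False by blast
    then show ?thesis using False sigmak_divide[of 4 1 n] by (simp only:) simp
  qed
  finally show ?thesis .
qed

text \<open>Both divisor sums vanish at 0, so the representation of 0 enters as a separate term. The
  formula then covers every pair in the convolution.\<close>

lemma real_card_four_squares:
  "real (card (four_squares (int n))) =
    (if n = 0 then 1 else 0) + 8 * (sig (real n) - 4 * sig (real n / 4))"
proof (cases "n = 0")
  case False
  then have "real_of_int (int (card (four_squares (int n)))) = real_of_int (8 * signed_sigma (int n))"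
    using card_four_squares by simp
  then show ?thesis using False signed_sigma_eq[of n] by simp
qed (simp add: four_squares_zero)

section \<open>Convolution sums\<close>

lemma finite_linear_pairs:
  fixes a b n :: nat
  assumes "a > 0" "b > 0"
  shows "finite {(l, m). a * l + b * m = n}"
proof (rule finite_subset)
  have "l \<le> a * l" "m \<le> b * m" for l m using assms by auto
  then show "{(l, m). a * l + b * m = n} \<subseteq> {..n} \<times> {..n}"
    by (auto intro: trans_le_add1 trans_le_add2)
qed auto

text \<open>Only pairs with \<open>p dvd l\<close> and \<open>q dvd m\<close> contribute; dividing
  these out moves \<open>p\<close> and \<open>q\<close> into the coefficients.\<close>

lemma W_scaled:
  assumes "n \<ge> 1" "a > 0" "b > 0" "p > 0" "q > 0"
  shows "(\<Sum>(l, m) | a * l + b * m = n. sig (real l / real p) * sig (real m / real q)) =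
    W (a * p) (b * q) (real n)"
proof -
  let ?A = "{(l, m). a * l + b * m = n}"
  have "(\<Sum>(l, m) \<in> ?A. sig (real l / real p) * sig (real m / real q)) =
      (\<Sum>(l, m) \<in> {(l, m) \<in> ?A. p dvd l \<and> q dvd m}. sig (real l / real p) * sig (real m / real q))"
    using assms finite_linear_pairs[of a b n]
    by (intro sum.mono_neutral_right) (auto simp: sigmak_divide split: if_splits)
  also have "\<dots> = (\<Sum>(l, m) | (a * p) * l + (b * q) * m = n. sig (real l) * sig (real m))"
    by (rule sum.reindex_bij_witness[of _ "\<lambda>(l, m). (p * l, q * m)" "\<lambda>(l, m). (l div p, m div q)"])
      (use assms in \<open>auto simp: algebra_simps elim!: dvdE\<close>)
  finally show ?thesis using assms by (simp add: W_def case_prod_unfold)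
qed

text \<open>The linear form takes only multiples of \<open>k\<close>, so the index set is empty for
  the remaining positive \<open>n\<close>.\<close>

lemma W_common_factor:
  assumes "k > 0"
  shows "W (k * a) (k * b) (real n) = W a b (real n / real k)"
proof (cases "n \<ge> 1 \<and> k dvd n")
  case True
  then obtain m where m: "n = k * m" "m \<ge> 1" by (auto elim!: dvdE)
  have "k * a * i + k * b * j = k * m \<longleftrightarrow> a * i + b * j = m" for i j
  proof -
    have "k * a * i + k * b * j = k * (a * i + b * j)" by (simp add: algebra_simps)
    then show ?thesis using assms by simp
  qed
  then have "W (k * a) (k * b) (real n) = W a b (real m)"
    using m assms unfolding W_def by (simp flip: of_nat_mult)
  then show ?thesis using m assms by simp
next
  case False
  have "{(l, m). k * a * l + k * b * m = n} = {}" if "n \<ge> 1"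
    using that False by (auto simp: mult.assoc)
  then show ?thesis using False is_pos_nat_divide[OF assms, of n] by (auto simp: W_def)
qed

section \<open>Representations by the form in eight variables\<close>

text \<open>The values \<open>l\<close> and \<open>m\<close> of the two sums of four squares split
  the 8-tuples into disjoint fibres, each a product of two sets \<open>four_squares\<close>.\<close>

lemma Nrep_eq_sum:
  assumes "a > 0" "b > 0"
  shows "Nrep a b n = (\<Sum>(l, m) | a * l + b * m = n.
    card (four_squares (int l)) * card (four_squares (int m)))"
proof -
  let ?X = "{x :: nat \<Rightarrow> int. (\<forall>i\<ge>8. x i = 0) \<and>
      int n = int a * (\<Sum>i<4. (x i)^2) + int b * (\<Sum>i\<in>{4..<8}. (x i)^2)}"
  let ?I = "{(l, m). a * l + b * m = n}"
  let ?F = "\<lambda>(l, m). four_squares (int l) \<times> four_squares (int m)"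
  let ?to = "\<lambda>x :: nat \<Rightarrow> int. ((x 0, x 1, x 2, x 3), (x 4, x 5, x 6, x 7))"
  let ?from = "\<lambda>((y0, y1, y2, y3), (y4, y5, y6, y7)). \<lambda>i :: nat.
      if i < 8 then [y0, y1, y2, y3, y4, y5, y6, y7] ! i else 0 :: int"
  have sums: "(\<Sum>i<4. (x i)^2) = (x 0)\<^sup>2 + (x 1)\<^sup>2 + (x 2)\<^sup>2 + (x 3)\<^sup>2"
    "(\<Sum>i\<in>{4..<8}. (x i)^2) = (x 4)\<^sup>2 + (x 5)\<^sup>2 + (x 6)\<^sup>2 + (x 7)\<^sup>2" for x :: "nat \<Rightarrow> int"
  proof -
    have "{..<4 :: nat} = {0, 1, 2, 3}" "{4..<8 :: nat} = {4, 5, 6, 7}" by auto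
    then show "(\<Sum>i<4. (x i)^2) = (x 0)\<^sup>2 + (x 1)\<^sup>2 + (x 2)\<^sup>2 + (x 3)\<^sup>2"
      "(\<Sum>i\<in>{4..<8}. (x i)^2) = (x 4)\<^sup>2 + (x 5)\<^sup>2 + (x 6)\<^sup>2 + (x 7)\<^sup>2" by simp_all
  qed
  have "bij_betw ?to ?X (\<Union>(?F ` ?I))"
  proof (rule bij_betw_byWitness[of _ ?from])
    show "\<forall>x \<in> ?X. ?from (?to x) = x"
    proof (intro ballI ext)
      fix x and i :: nat assume x: "x \<in> ?X"
      \<comment> \<open>Below 8 the list lookup is evaluated index by index; from 8 on both
        functions are 0.\<close>
      have "i < 8 \<Longrightarrow> i \<in> {0, 1, 2, 3, 4, 5, 6, 7}" by auto
      then show "?from (?to x) i = x i" using x by (cases "i < 8") auto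
    qed
    show "\<forall>t \<in> \<Union>(?F ` ?I). ?to (?from t) = t" by auto
    show "?to ` ?X \<subseteq> \<Union>(?F ` ?I)"
    proof
      fix t assume "t \<in> ?to ` ?X"
      then obtain x where x: "x \<in> ?X" "t = ?to x" by blast
      define l m where "l = nat (\<Sum>i<4. (x i)^2)" and "m = nat (\<Sum>i\<in>{4..<8}. (x i)^2)"
      have lm: "int l = (\<Sum>i<4. (x i)^2)" "int m = (\<Sum>i\<in>{4..<8}. (x i)^2)"
        by (auto simp: l_def m_def sum_nonneg)
      then have "int (a * l + b * m) = int n" using x by simp
      then have "(l, m) \<in> ?I" by (simp only: of_nat_eq_iff) simp
      moreover have "t \<in> ?F (l, m)" using x lm by (simp add: sums four_squares_def)
      ultimately show "t \<in> \<Union>(?F ` ?I)" by blast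
    qed
    show "?from ` (\<Union>(?F ` ?I)) \<subseteq> ?X"
      by (auto simp: four_squares_def sums)
  qed
  then have "Nrep a b n = card (\<Union>(?F ` ?I))"
    unfolding Nrep_def by (rule bij_betw_same_card)
  also have "\<dots> = (\<Sum>i \<in> ?I. card (?F i))"
  proof (rule card_UN_disjoint)
    show "finite ?I" by (rule finite_linear_pairs[OF assms])
    show "\<forall>i \<in> ?I. finite (?F i)" by auto
    show "\<forall>i \<in> ?I. \<forall>j \<in> ?I. i \<noteq> j \<longrightarrow> ?F i \<inter> ?F j = {}"
      by (auto simp: four_squares_def)
  qed
  finally show ?thesis by (simp add: case_prod_unfold card_cartesian_product)
qed

theorem theorem4p1:
  fixes n :: nat
  assumes "n \<ge> 1"
  shows "real (Nrep 1 9 n) =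
     8 * sig (real n) - 32 * sig (real n / 4) + 8 * sig (real n / 9) - 32 * sig (real n / 36)
     + 64 * W 1 9 (real n) + 1024 * W 1 9 (real n / 4)
     - 256 * (W 4 9 (real n) + W 1 36 (real n))"
proof -
  \<comment> \<open>The indicator of 0 carries the representation of 0: products with one
    \<open>\<delta>\<close> give the divisor sums, and \<open>s l * s m\<close> gives the
    convolutions.\<close>
  define \<delta> :: "nat \<Rightarrow> real" where "\<delta> l = (if l = 0 then 1 else 0)" for l
  define s where "s l = sig (real l) - 4 * sig (real l / 4)" for l :: nat
  let ?I = "{(l :: nat, m :: nat). 1 * l + 9 * m = n}"
  have fin: "finite ?I" by (rule finite_linear_pairs) auto
  have "real (Nrep 1 9 n) = (\<Sum>(l, m) \<in> ?I. (\<delta> l + 8 * s l) * (\<delta> m + 8 * s m))"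
    by (simp add: Nrep_eq_sum real_card_four_squares \<delta>_def s_def case_prod_unfold)
  also have "\<dots> = (\<Sum>(l, m) \<in> ?I. \<delta> l * \<delta> m) + 8 * (\<Sum>(l, m) \<in> ?I. s l * \<delta> m)
      + 8 * (\<Sum>(l, m) \<in> ?I. \<delta> l * s m) + 64 * (\<Sum>(l, m) \<in> ?I. s l * s m)"
    by (simp add: case_prod_unfold sum_distrib_left algebra_simps flip: sum.distrib)
  also have "(\<Sum>(l, m) \<in> ?I. \<delta> l * \<delta> m) = 0"
    using assms by (intro sum.neutral) (auto simp: \<delta>_def)
  \<comment> \<open>The factor \<open>\<delta> m\<close> forces \<open>m = 0\<close>, hence
    \<open>l = n\<close>.\<close>
  also have "(\<Sum>(l, m) \<in> ?I. s l * \<delta> m) = (\<Sum>(l, m) \<in> {(n, 0)}. s l * \<delta> m)"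
    using fin by (intro sum.mono_neutral_right) (auto simp: \<delta>_def split: if_splits)
  also have "\<dots> = s n" by (simp add: \<delta>_def)
  \<comment> \<open>Here \<open>l = 0\<close> leaves \<open>9 * m = n\<close>, so both sides vanish
    unless 9 divides \<open>n\<close>.\<close>
  also have "(\<Sum>(l, m) \<in> ?I. \<delta> l * s m) = sig (real n / 9) - 4 * sig (real n / 36)"
  proof (cases "9 dvd n")
    case True
    then obtain k where k: "n = 9 * k" by blast
    have "(\<Sum>(l, m) \<in> ?I. \<delta> l * s m) = (\<Sum>(l, m) \<in> {(0, k)}. \<delta> l * s m)"
      using fin k by (intro sum.mono_neutral_right) (auto simp: \<delta>_def split: if_splits)
    then show ?thesis by (simp add: \<delta>_def s_def k)
  next
    case False
    then have "\<not> 36 dvd n" using dvd_trans[of 9 36 n] by auto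
    moreover have "(\<Sum>(l, m) \<in> ?I. \<delta> l * s m) = 0"
      using False by (intro sum.neutral) (auto simp: \<delta>_def)
    ultimately show ?thesis using False sigmak_divide[of 9 1 n] sigmak_divide[of 36 1 n] by simp
  qed
  also have "(\<Sum>(l, m) \<in> ?I. s l * s m) = W 1 9 (real n) - 4 * W 1 36 (real n)
      - 4 * W 4 9 (real n) + 16 * W 1 9 (real n / 4)"
  proof -
    let ?c = "\<lambda>p q. \<Sum>(l, m) \<in> ?I. sig (real l / real p) * sig (real m / real q)"
    have "(\<Sum>(l, m) \<in> ?I. s l * s m) = ?c 1 1 - 4 * ?c 1 4 - 4 * ?c 4 1 + 16 * ?c 4 4"
      by (simp add: s_def case_prod_unfold sum_distrib_left algebra_simps
          flip: sum.distrib sum_subtractf)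
    moreover have "?c p q = W p (9 * q) (real n)" if "p > 0" "q > 0" for p q
      using W_scaled[of n 1 9 p q] assms that by simp
    note this[of 1 1] this[of 1 4] this[of 4 1] this[of 4 4]
    \<comment> \<open>The product of the two quarter-argument terms has coefficients 4 and 36, whose
      common factor 4 passes to the argument.\<close>
    moreover have "W 4 36 (real n) = W 1 9 (real n / 4)"
      using W_common_factor[of 4 1 9 n] by simp
    ultimately show ?thesis by simp
  qed
  finally show ?thesis by (simp add: s_def algebra_simps)
qed

end
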